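(* Let $A\in\mathcal A$ with $\mu(A)>0$ and $\mu(S\setminus A)>0$. For any $f\in L_p(S;X)$, the metric projection $P_{L_p(A;X)}:L_p(S;X)\to L_p(A;X)$ satisfies: (a) $P_{L_p(A;X)}(f)=f_A$; (b) $P_{L_p(A;X)}(\lambda f)=\lambda f_A$, for any $\lambda\in\mathbb R$.
   Context: Let $(S,\mathcal A,\mu)$ be a positive measure space, $X$ a real uniformly convex and uniformly smooth Banach space, and $1<p<\infty$. $L_p(S;X)$ is the Bochner space of ($\mu$-equivalence classes of) strongly measurable $f:S\to X$ with $\|f\|_{L_p(S;X)}=\left(\int_S\|f(s)\|_X^p\,d\mu(s)\right)^{1/p}<\infty$; it is a uniformly convex and uniformly smooth Banach space. $L_p(A;X)$ is the closed subspace $\{f\in L_p(S;X): f(s)=\theta \text{ for } \mu\text{-a.e. } s\in S\setminus A\}$ ($\theta$ denotes the zero vector). For $f\in L_p(S;X)$, $f_A$ is defined by $f_A(s)=f(s)$ for $s\in A$ and $f_A(s)=\theta$ for $s\notin A$. For a nonempty closed convex subset $C$ of a uniformly convex and uniformly smooth Banach space $Z$, the metric projection $P_C:Z\to C$ assigns to $x$ the unique point $P_Cx\in C$ with $\|x-P_Cx\|\le\|x-z\|$ for all $z\in C$. *)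

theory Defs
  imports "HOL-Analysis.Analysis"
begin

definition uniformly_convex :: "'b::real_normed_vector itself \<Rightarrow> bool" where
  "uniformly_convex (T :: 'b itself) \<longleftrightarrow>
     (\<forall>\<epsilon>>0. \<exists>\<delta>>0. \<forall>x y :: 'b. norm x = 1 \<longrightarrow> norm y = 1 \<longrightarrow> norm (x - y) \<ge> \<epsilon> \<longrightarrow>
        norm ((x + y) /\<^sub>R 2) \<le> 1 - \<delta>)"

(* Equivalent to rho(t)/t --> 0 as t --> 0+, where rho is the modulus of smoothness;
   this form avoids a supremum over the empty unit sphere of the zero space. *)
definition uniformly_smooth :: "'b::real_normed_vector itself \<Rightarrow> bool" where
  "uniformly_smooth (T :: 'b itself) \<longleftrightarrow>
     (\<forall>\<epsilon>>0. \<exists>\<delta>>0. \<forall>x y :: 'b. norm x = 1 \<longrightarrow> norm y \<le> \<delta> \<longrightarrow>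
        norm (x + y) + norm (x - y) \<le> 2 + \<epsilon> * norm y)"

(* For a non-separable target, Borel measurability would be too weak. *)
definition strongly_measurable :: "'a measure \<Rightarrow> ('a \<Rightarrow> 'b::real_normed_vector) \<Rightarrow> bool" where
  "strongly_measurable M f \<longleftrightarrow>
     (\<exists>s :: nat \<Rightarrow> 'a \<Rightarrow> 'b. (\<forall>i. simple_function M (s i)) \<and>
        (\<forall>x\<in>space M. (\<lambda>i. s i x) \<longlonglongrightarrow> f x))"

definition Lp_fun :: "'a measure \<Rightarrow> real \<Rightarrow> ('a \<Rightarrow> 'b::real_normed_vector) set" where
  "Lp_fun M p =
     {f. strongly_measurable M f \<and> (\<integral>\<^sup>+ x. ennreal (norm (f x) powr p) \<partial>M) < \<infinity>}"

definition Lp_rel ::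
  "'a measure \<Rightarrow> real \<Rightarrow> (('a \<Rightarrow> 'b::real_normed_vector) \<times> ('a \<Rightarrow> 'b)) set" where
  "Lp_rel M p = {(f, g). f \<in> Lp_fun M p \<and> g \<in> Lp_fun M p \<and> (AE x in M. f x = g x)}"

definition Lp :: "'a measure \<Rightarrow> real \<Rightarrow> ('a \<Rightarrow> 'b::real_normed_vector) set set" where
  "Lp M p = Lp_fun M p // Lp_rel M p"

definition Lp_class ::
  "'a measure \<Rightarrow> real \<Rightarrow> ('a \<Rightarrow> 'b::real_normed_vector) \<Rightarrow> ('a \<Rightarrow> 'b) set" where
  "Lp_class M p f = Lp_rel M p `` {f}"

(* The operations below are applied to representatives; the results do not depend on the choice,
   so each union is one equivalence class and the image in Lp_norm is a singleton. *)

definition Lp_norm :: "'a measure \<Rightarrow> real \<Rightarrow> ('a \<Rightarrow> 'b::real_normed_vector) set \<Rightarrow> real" where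
  "Lp_norm M p F = the_elem ((\<lambda>f. (\<integral>x. norm (f x) powr p \<partial>M) powr (1 / p)) ` F)"

definition Lp_diff ::
  "'a measure \<Rightarrow> real \<Rightarrow> ('a \<Rightarrow> 'b::real_normed_vector) set \<Rightarrow> ('a \<Rightarrow> 'b) set \<Rightarrow> ('a \<Rightarrow> 'b) set" where
  "Lp_diff M p F G = (\<Union>f\<in>F. \<Union>g\<in>G. Lp_class M p (\<lambda>x. f x - g x))"

definition Lp_scale ::
  "'a measure \<Rightarrow> real \<Rightarrow> real \<Rightarrow> ('a \<Rightarrow> 'b::real_normed_vector) set \<Rightarrow> ('a \<Rightarrow> 'b) set" where
  "Lp_scale M p c F = (\<Union>f\<in>F. Lp_class M p (\<lambda>x. c *\<^sub>R f x))"

definition Lp_restrict ::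
  "'a measure \<Rightarrow> real \<Rightarrow> 'a set \<Rightarrow> ('a \<Rightarrow> 'b::real_normed_vector) set \<Rightarrow> ('a \<Rightarrow> 'b) set" where
  "Lp_restrict M p A F = (\<Union>f\<in>F. Lp_class M p (\<lambda>x. if x \<in> A then f x else 0))"

definition Lp_dist ::
  "'a measure \<Rightarrow> real \<Rightarrow> ('a \<Rightarrow> 'b::real_normed_vector) set \<Rightarrow> ('a \<Rightarrow> 'b) set \<Rightarrow> real" where
  "Lp_dist M p F G = Lp_norm M p (Lp_diff M p F G)"

definition Lp_on :: "'a measure \<Rightarrow> real \<Rightarrow> 'a set \<Rightarrow> ('a \<Rightarrow> 'b::real_normed_vector) set set" where
  "Lp_on M p A = {F \<in> Lp M p. \<forall>f\<in>F. AE x in M. x \<notin> A \<longrightarrow> f x = 0}"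

(* Meaningful only where the nearest point exists and is unique. *)
definition metric_projection :: "('z \<Rightarrow> 'z \<Rightarrow> real) \<Rightarrow> 'z set \<Rightarrow> 'z \<Rightarrow> 'z" where
  "metric_projection d C x = (THE y. y \<in> C \<and> (\<forall>z\<in>C. d x y \<le> d x z))"

end

theory Submission
  imports Defs
begin

text \<open>For \<open>g\<close> vanishing off \<open>A\<close>, splitting the integral gives
  \<open>\<parallel>f - g\<parallel>\<^sup>p = \<parallel>f - f\<^sub>A\<parallel>\<^sup>p + \<parallel>f\<^sub>A - g\<parallel>\<^sup>p\<close>.
  Hence \<open>f\<^sub>A\<close> is a nearest point of \<open>L\<^sub>p(A; X)\<close>, and any other nearest point \<open>g\<close> satisfies
  \<open>\<parallel>f\<^sub>A - g\<parallel> = 0\<close>. Part (b) is part (a) for \<open>\<lambda>f\<close>, since \<open>(\<lambda>f)\<^sub>A = \<lambda>f\<^sub>A\<close>.\<close>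

section \<open>Strong measurability and pointwise operations\<close>

lemma strongly_measurable_borel:
  assumes "strongly_measurable M f"
  shows "f \<in> borel_measurable M"
  using assms unfolding strongly_measurable_def
  by (blast intro: borel_measurable_LIMSEQ_metric borel_measurable_simple_function)

text \<open>The approximating simple functions are subtracted termwise. Arguing through Borel
  measurability would fail for a non-separable target, where differences of Borel functions need not
  be Borel.\<close>

lemma strongly_measurable_diff:
  assumes "strongly_measurable M f" "strongly_measurable M g"
  shows "strongly_measurable M (\<lambda>x. f x - g x)"
proof -
  obtain s t where "\<forall>i. simple_function M (s i)" "\<forall>x\<in>space M. (\<lambda>i. s i x) \<longlonglongrightarrow> f x"
    "\<forall>i. simple_function M (t i)" "\<forall>x\<in>space M. (\<lambda>i. t i x) \<longlonglongrightarrow> g x"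
    using assms unfolding strongly_measurable_def by blast
  then show ?thesis unfolding strongly_measurable_def
    by (intro exI[of _ "\<lambda>i x. s i x - t i x"])
      (auto intro: tendsto_diff)
qed

lemma strongly_measurable_scaleR:
  assumes "strongly_measurable M f"
  shows "strongly_measurable M (\<lambda>x. c *\<^sub>R f x)"
proof -
  obtain s where "\<forall>i. simple_function M (s i)" "\<forall>x\<in>space M. (\<lambda>i. s i x) \<longlonglongrightarrow> f x"
    using assms unfolding strongly_measurable_def by blast
  then show ?thesis unfolding strongly_measurable_def
    by (intro exI[of _ "\<lambda>i x. c *\<^sub>R s i x"])
      (auto intro: tendsto_scaleR simple_function_compose1[where g = "\<lambda>y. c *\<^sub>R y"])
qed

lemma strongly_measurable_restrict:
  assumes "strongly_measurable M f" "A \<in> sets M"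
  shows "strongly_measurable M (\<lambda>x. if x \<in> A then f x else 0)"
proof -
  obtain s where "\<forall>i. simple_function M (s i)" "\<forall>x\<in>space M. (\<lambda>i. s i x) \<longlonglongrightarrow> f x"
    using assms unfolding strongly_measurable_def by blast
  then show ?thesis unfolding strongly_measurable_def
    by (intro exI[of _ "\<lambda>i x. if x \<in> A then s i x else 0"])
      (auto intro!: simple_function_If_set assms(2))
qed

section \<open>Membership of functions in \<open>Lp_fun M p\<close>\<close>

lemma Lp_fun_iff:
  "f \<in> Lp_fun M p \<longleftrightarrow> strongly_measurable M f \<and> integrable M (\<lambda>x. norm (f x) powr p)"
proof -
  \<comment> \<open>Integrability asks for a measurable integrand besides a finite integral; strong
    measurability supplies it.\<close>
  have "(\<lambda>x. norm (f x) powr p) \<in> borel_measurable M" if "strongly_measurable M f"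
    using strongly_measurable_borel[OF that] by measurable
  then show ?thesis
    by (auto simp: Lp_fun_def integrable_iff_bounded)
qed

text \<open>A crude substitute for Minkowski's inequality: it serves only to show that differences
  stay in \<open>Lp_fun M p\<close>, so the constant is irrelevant. The power of the maximum is one
  of the two summands.\<close>

lemma norm_diff_powr_le:
  fixes a b :: "'b::real_normed_vector"
  assumes "0 \<le> p"
  shows "norm (a - b) powr p \<le> 2 powr p * (norm a powr p + norm b powr p)"
proof -
  have "norm (a - b) \<le> 2 * max (norm a) (norm b)"
    using norm_triangle_ineq4[of a b] by linarith
  then have "norm (a - b) powr p \<le> (2 * max (norm a) (norm b)) powr p"
    using assms by (intro powr_mono2) auto
  also have "\<dots> = 2 powr p * max (norm a) (norm b) powr p"
    by (simp add: powr_mult)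
  also have "\<dots> \<le> 2 powr p * (norm a powr p + norm b powr p)"
    by (intro mult_left_mono) (auto simp: max_def)
  finally show ?thesis .
qed

lemma Lp_fun_diff:
  assumes "0 \<le> p" "f \<in> Lp_fun M p" "g \<in> Lp_fun M p"
  shows "(\<lambda>x. f x - g x) \<in> Lp_fun M p"
proof -
  have meas: "strongly_measurable M (\<lambda>x. f x - g x)"
    using assms by (auto simp: Lp_fun_iff intro: strongly_measurable_diff)
  have "integrable M (\<lambda>x. norm (f x - g x) powr p)"
  proof (rule Bochner_Integration.integrable_bound)
    show "integrable M (\<lambda>x. 2 powr p * (norm (f x) powr p + norm (g x) powr p))"
      using assms by (simp add: Lp_fun_iff)
    show "(\<lambda>x. norm (f x - g x) powr p) \<in> borel_measurable M"
      using strongly_measurable_borel[OF meas] by measurable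
    show "AE x in M. norm (norm (f x - g x) powr p)
        \<le> norm (2 powr p * (norm (f x) powr p + norm (g x) powr p))"
      using norm_diff_powr_le[OF assms(1)] by (intro AE_I2) (simp add: abs_mult)
  qed
  with meas show ?thesis by (simp add: Lp_fun_iff)
qed

lemma Lp_fun_scaleR:
  assumes "f \<in> Lp_fun M p"
  shows "(\<lambda>x. c *\<^sub>R f x) \<in> Lp_fun M p"
  using assms by (auto simp: Lp_fun_iff powr_mult intro: strongly_measurable_scaleR)

lemma Lp_fun_restrict:
  assumes "f \<in> Lp_fun M p" "A \<in> sets M"
  shows "(\<lambda>x. if x \<in> A then f x else 0) \<in> Lp_fun M p"
proof -
  \<comment> \<open>Off \<open>A\<close> the value is \<open>0 powr p\<close>, which is 0 for every
    real \<open>p\<close>.\<close>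
  have "(\<lambda>x. norm (if x \<in> A then f x else 0) powr p) = (\<lambda>x. indicator A x *\<^sub>R norm (f x) powr p)"
    by (auto simp: indicator_def)
  then show ?thesis
    using assms by (simp add: Lp_fun_iff strongly_measurable_restrict integrable_mult_indicator
        del: real_scaleR_def)
qed

section \<open>Passing between classes and representatives\<close>

lemma equiv_Lp_rel: "equiv (Lp_fun M p) (Lp_rel M p)"
  unfolding equiv_def refl_on_def sym_def trans_def Lp_rel_def by auto

lemma Lp_class_eq_iff:
  assumes "f \<in> Lp_fun M p" "g \<in> Lp_fun M p"
  shows "Lp_class M p f = Lp_class M p g \<longleftrightarrow> (AE x in M. f x = g x)"
  using eq_equiv_class_iff[OF equiv_Lp_rel assms] assms by (simp add: Lp_class_def Lp_rel_def)

lemma in_Lp_class_iff: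
  "g \<in> Lp_class M p f \<longleftrightarrow> f \<in> Lp_fun M p \<and> g \<in> Lp_fun M p \<and> (AE x in M. f x = g x)"
  by (simp add: Lp_class_def Lp_rel_def)

lemma Lp_class_self: "f \<in> Lp_fun M p \<Longrightarrow> f \<in> Lp_class M p f"
  by (simp add: in_Lp_class_iff)

lemma Lp_cases:
  assumes "F \<in> Lp M p"
  obtains f where "f \<in> Lp_fun M p" "F = Lp_class M p f"
  using assms unfolding Lp_def Lp_class_def by (auto elim: quotientE)

text \<open>Well-definedness: a.e. equal representatives give a.e. equal differences, so all classes
  in the union coincide, and the union is not over an empty family since \<open>f\<close> and
  \<open>g\<close> lie in their own classes. Scaling and restriction follow the same
  pattern.\<close>

lemma Lp_diff_class:
  assumes "0 \<le> p" "f \<in> Lp_fun M p" "g \<in> Lp_fun M p"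
  shows "Lp_diff M p (Lp_class M p f) (Lp_class M p g) = Lp_class M p (\<lambda>x. f x - g x)"
proof -
  have "Lp_class M p (\<lambda>x. f' x - g' x) = Lp_class M p (\<lambda>x. f x - g x)"
    if "f' \<in> Lp_class M p f" "g' \<in> Lp_class M p g" for f' g'
    using that assms by (subst Lp_class_eq_iff) (auto simp: in_Lp_class_iff Lp_fun_diff)
  then show ?thesis
    using assms(2,3)[THEN Lp_class_self] unfolding Lp_diff_def by blast
qed

lemma Lp_scale_class:
  assumes "f \<in> Lp_fun M p"
  shows "Lp_scale M p c (Lp_class M p f) = Lp_class M p (\<lambda>x. c *\<^sub>R f x)"
proof -
  have "Lp_class M p (\<lambda>x. c *\<^sub>R f' x) = Lp_class M p (\<lambda>x. c *\<^sub>R f x)"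
    if "f' \<in> Lp_class M p f" for f'
    using that by (subst Lp_class_eq_iff) (auto simp: in_Lp_class_iff Lp_fun_scaleR)
  then show ?thesis
    using assms[THEN Lp_class_self] unfolding Lp_scale_def by blast
qed

lemma Lp_restrict_class:
  assumes "f \<in> Lp_fun M p" "A \<in> sets M"
  shows "Lp_restrict M p A (Lp_class M p f) = Lp_class M p (\<lambda>x. if x \<in> A then f x else 0)"
proof -
  have "Lp_class M p (\<lambda>x. if x \<in> A then f' x else 0)
      = Lp_class M p (\<lambda>x. if x \<in> A then f x else 0)"
    if "f' \<in> Lp_class M p f" for f'
    using that assms(2) by (subst Lp_class_eq_iff) (auto simp: in_Lp_class_iff Lp_fun_restrict)
  then show ?thesis
    using assms(1)[THEN Lp_class_self] unfolding Lp_restrict_def by blast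
qed

text \<open>A.e. equal representatives have equal integrals, so the image under
  \<open>the_elem\<close> is that of a constant function on a class that contains \<open>f\<close>,
  hence a singleton.\<close>

lemma Lp_norm_class:
  assumes "f \<in> Lp_fun M p"
  shows "Lp_norm M p (Lp_class M p f) = (\<integral>x. norm (f x) powr p \<partial>M) powr (1 / p)"
proof -
  have "(\<integral>x. norm (g x) powr p \<partial>M) = (\<integral>x. norm (f x) powr p \<partial>M)" if "g \<in> Lp_class M p f" for g
    using that by (intro integral_cong_AE)
      (auto simp: in_Lp_class_iff Lp_fun_iff intro: borel_measurable_integrable)
  then have "(\<lambda>g. (\<integral>x. norm (g x) powr p \<partial>M) powr (1 / p)) ` Lp_class M p f
      = (\<lambda>g. (\<integral>x. norm (f x) powr p \<partial>M) powr (1 / p)) ` Lp_class M p f"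
    by (intro image_cong) (simp_all only:)
  also have "\<dots> = {(\<integral>x. norm (f x) powr p \<partial>M) powr (1 / p)}"
    using assms[THEN Lp_class_self] by blast
  finally
  show ?thesis by (simp add: Lp_norm_def)
qed

lemma Lp_dist_class:
  assumes "0 \<le> p" "f \<in> Lp_fun M p" "g \<in> Lp_fun M p"
  shows "Lp_dist M p (Lp_class M p f) (Lp_class M p g)
    = (\<integral>x. norm (f x - g x) powr p \<partial>M) powr (1 / p)"
  using assms by (simp add: Lp_dist_def Lp_diff_class Lp_norm_class Lp_fun_diff)

section \<open>The subspace \<open>Lp_on M p A\<close> and nearest points in it\<close>

lemma Lp_class_in_Lp_on_iff:
  assumes "f \<in> Lp_fun M p"
  shows "Lp_class M p f \<in> Lp_on M p A \<longleftrightarrow> (AE x in M. x \<notin> A \<longrightarrow> f x = 0)"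
proof -
  \<comment> \<open>Vanishing a.e. off \<open>A\<close> survives a change on a null set, so a single
    representative decides membership.\<close>
  have "AE x in M. x \<notin> A \<longrightarrow> g x = 0"
    if "AE x in M. x \<notin> A \<longrightarrow> f x = 0" "AE x in M. f x = g x" for g
    using that by eventually_elim auto
  moreover have "Lp_class M p f \<in> Lp M p"
    using assms by (auto simp: Lp_def Lp_class_def intro: quotientI)
  ultimately show ?thesis
    using assms Lp_class_self[OF assms] by (auto simp: Lp_on_def in_Lp_class_iff)
qed

text \<open>The functions \<open>f - h\<close> and \<open>h - g\<close> have a.e. disjoint supports:
  the first vanishes on \<open>A\<close>, where \<open>h = f\<close>, and the second off
  \<open>A\<close>, where \<open>h\<close> and a.e. \<open>g\<close> are 0. Hence the
  \<open>p\<close>-th powers of their norms add up pointwise a.e.\<close>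

lemma integral_powr_split:
  assumes "0 \<le> p" "f \<in> Lp_fun M p" "g \<in> Lp_fun M p" "A \<in> sets M"
    and g: "AE x in M. x \<notin> A \<longrightarrow> g x = 0"
  defines "h \<equiv> \<lambda>x. if x \<in> A then f x else 0"
  shows "(\<integral>x. norm (f x - g x) powr p \<partial>M)
    = (\<integral>x. norm (f x - h x) powr p \<partial>M) + (\<integral>x. norm (h x - g x) powr p \<partial>M)"
proof -
  have h: "h \<in> Lp_fun M p" unfolding h_def by (intro Lp_fun_restrict assms)
  have int: "integrable M (\<lambda>x. norm (f x - g x) powr p)"
    "integrable M (\<lambda>x. norm (f x - h x) powr p)" "integrable M (\<lambda>x. norm (h x - g x) powr p)"
    using Lp_fun_diff assms(1-3) h unfolding Lp_fun_iff by blast+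
  have "AE x in M. norm (f x - g x) powr p
      = norm (f x - h x) powr p + norm (h x - g x) powr p"
    using g by eventually_elim (auto simp: h_def)
  then have "(\<integral>x. norm (f x - g x) powr p \<partial>M)
      = (\<integral>x. norm (f x - h x) powr p + norm (h x - g x) powr p \<partial>M)"
    using int by (intro integral_cong_AE) (auto intro: borel_measurable_integrable)
  with int show ?thesis by simp
qed

lemma metric_projection_Lp_on_class:
  fixes f :: "'a \<Rightarrow> 'b::real_normed_vector"
  assumes p: "0 < p" and f: "f \<in> Lp_fun M p" and A: "A \<in> sets M"
  shows "metric_projection (Lp_dist M p) (Lp_on M p A) (Lp_class M p f)
    = Lp_class M p (\<lambda>x. if x \<in> A then f x else 0)"
proof -
  define h where "h = (\<lambda>x. if x \<in> A then f x else 0)"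
  have h: "h \<in> Lp_fun M p" unfolding h_def by (intro Lp_fun_restrict f A)
  have h_on: "Lp_class M p h \<in> Lp_on M p A"
    using h by (auto simp: Lp_class_in_Lp_on_iff h_def)
  have split: "(\<integral>x. norm (f x - g x) powr p \<partial>M)
      = (\<integral>x. norm (f x - h x) powr p \<partial>M) + (\<integral>x. norm (h x - g x) powr p \<partial>M)"
    if "g \<in> Lp_fun M p" "Lp_class M p g \<in> Lp_on M p A"
    for g :: "'a \<Rightarrow> 'b"
    using integral_powr_split[of p f M g A] that p f A
    by (simp add: h_def Lp_class_in_Lp_on_iff)
  have on_cases: "\<exists>g. g \<in> Lp_fun M p \<and> G = Lp_class M p g" if "G \<in> Lp_on M p A"
    for G :: "('a \<Rightarrow> 'b) set"
    using that Lp_cases unfolding Lp_on_def by blast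
  show ?thesis
    unfolding metric_projection_def h_def[symmetric]
  proof (rule the_equality, intro conjI ballI)
    show "Lp_class M p h \<in> Lp_on M p A" by (rule h_on)
    fix G :: "('a \<Rightarrow> 'b) set"
    assume G: "G \<in> Lp_on M p A"
    then obtain g where g: "g \<in> Lp_fun M p" "G = Lp_class M p g" using on_cases by blast
    \<comment> \<open>The second summand of \<open>split\<close> is nonnegative.\<close>
    have "(\<integral>x. norm (f x - h x) powr p \<partial>M) \<le> (\<integral>x. norm (f x - g x) powr p \<partial>M)"
      using split g G by simp
    then show "Lp_dist M p (Lp_class M p f) (Lp_class M p h) \<le> Lp_dist M p (Lp_class M p f) G"
      using p f g h by (simp add: Lp_dist_class powr_mono2)
  next
    fix G :: "('a \<Rightarrow> 'b) set"
    assume G: "G \<in> Lp_on M p A \<and>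
      (\<forall>Z\<in>Lp_on M p A. Lp_dist M p (Lp_class M p f) G \<le> Lp_dist M p (Lp_class M p f) Z)"
    then obtain g where g: "g \<in> Lp_fun M p" "G = Lp_class M p g" using on_cases by blast
    \<comment> \<open>For uniqueness, a minimiser \<open>G\<close> need only be tested against the
      competitor \<open>h\<close>.\<close>
    have "Lp_dist M p (Lp_class M p f) G \<le> Lp_dist M p (Lp_class M p f) (Lp_class M p h)"
      using G h_on by blast
    then have "(\<integral>x. norm (f x - g x) powr p \<partial>M) powr (1 / p)
        \<le> (\<integral>x. norm (f x - h x) powr p \<partial>M) powr (1 / p)"
      using p f g h by (simp add: Lp_dist_class)
    \<comment> \<open>The outer exponent \<open>1 / p\<close> is removed by contraposition, as this
      power is strictly increasing on nonnegative reals.\<close>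
    then have "(\<integral>x. norm (f x - g x) powr p \<partial>M) \<le> (\<integral>x. norm (f x - h x) powr p \<partial>M)"
      using p powr_less_mono2[of "1 / p" "\<integral>x. norm (f x - h x) powr p \<partial>M"
          "\<integral>x. norm (f x - g x) powr p \<partial>M"]
      by (force simp: not_le[symmetric])
    then have "(\<integral>x. norm (h x - g x) powr p \<partial>M) \<le> 0"
      using split g G by simp
    then have "(\<integral>x. norm (h x - g x) powr p \<partial>M) = 0"
      by (intro antisym) auto
    moreover have "integrable M (\<lambda>x. norm (h x - g x) powr p)"
      using Lp_fun_diff[of p h M g] p h g by (simp add: Lp_fun_iff)
    \<comment> \<open>A nonnegative integrable function with zero integral vanishes a.e.\<close>
    ultimately have "AE x in M. norm (h x - g x) powr p = 0"
      by (subst (asm) integral_nonneg_eq_0_iff_AE) auto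
    then have "AE x in M. g x = h x"
      by eventually_elim auto
    then show "G = Lp_class M p h"
      using g h by (simp add: Lp_class_eq_iff)
  qed
qed

theorem lemma4p1:
  fixes M :: "'a measure"
    and p :: real
    and A :: "'a set"
    and F :: "('a \<Rightarrow> 'b::banach) set"
  assumes "uniformly_convex TYPE('b)"
    and "uniformly_smooth TYPE('b)"
    and "1 < p"
    and "A \<in> sets M"
    and "emeasure M A > 0"
    and "emeasure M (space M - A) > 0"
    and "F \<in> Lp M p"
  shows "metric_projection (Lp_dist M p) (Lp_on M p A) F = Lp_restrict M p A F \<and>
    (\<forall>c::real. metric_projection (Lp_dist M p) (Lp_on M p A) (Lp_scale M p c F)
       = Lp_scale M p c (Lp_restrict M p A F))"
proof -
  obtain f where f: "f \<in> Lp_fun M p" and F: "F = Lp_class M p f"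
    using assms(7) by (rule Lp_cases)
  \<comment> \<open>Kept general in \<open>g\<close> so that it applies both to \<open>f\<close> and
    to its multiples.\<close>
  have proj: "metric_projection (Lp_dist M p) (Lp_on M p A) (Lp_class M p g)
      = Lp_class M p (\<lambda>x. if x \<in> A then g x else 0)" if "g \<in> Lp_fun M p" for g :: "'a \<Rightarrow> 'b"
    using assms(3,4) that by (intro metric_projection_Lp_on_class) auto
  \<comment> \<open>Truncation commutes with scaling because scaling fixes 0; this turns the second
    claim into the first one for the scaled function.\<close>
  have "(\<lambda>x. c *\<^sub>R (if x \<in> A then f x else 0)) = (\<lambda>x. if x \<in> A then c *\<^sub>R f x else 0)" for c
    by auto
  then show ?thesis
    using f assms(4)
    by (simp add: F proj Lp_restrict_class Lp_scale_class Lp_fun_scaleR Lp_fun_restrict)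
qed

end
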